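(* Let $K_1,K_2$ be positive integers. There exists a constant $K=K(K_1,K_2)>1$ such that the following holds. Let $T>0$, $R_0>0$, let $\Omega\subset\mathbb{R}^3$ be an open set containing $B(\mathbf{0},2R_0)$, and let $\mathbf{u}$ be a weak solution to the 3D Euler equations on $\Omega\times(0,2T)$ satisfying the local energy inequality. Then for every $R$ with $0<R\le R_0$ and every $(K_1,K_2)$-cover $\{B(\mathbf{x}_i,R)\}_{i=1}^n$ of $B(\mathbf{0},R_0)$ at scale $R$, $$\frac1K\,\varepsilon_0\le \varepsilon_R\le K\,\varepsilon_0 .$$
   Context: Notation: $B(\mathbf{x},r)$ and $S(\mathbf{x},r)$ are the ball and sphere in $\mathbb{R}^3$ with center $\mathbf{x}$ and radius $r$; $\mathcal{D}(U)$ denotes smooth functions with compact support in $U$. Euler equations: $\mathbf{u}_t+(\mathbf{u}\cdot\nabla)\mathbf{u}=-\nabla p$, $\operatorname{div}\mathbf{u}=0$, understood in the sense of distributions, with $\mathbf{u}\in L^3_{loc}$ in space-time and pressure $p\in L^{3/2}_{loc}$ (so that $-\Delta p=\partial_i\partial_j(u^iu^j)$ and all integrals below are well defined). The local energy inequality means $$\frac12\iint|\mathbf{u}|^2\partial_t\phi\,d\mathbf{x}\,dt+\iint\Bigl(\frac12|\mathbf{u}|^2+p\Bigr)\mathbf{u}\cdot\nabla\phi\,d\mathbf{x}\,dt\ge0$$ for all nonnegative test functions $\phi\in\mathcal{D}(\Omega\times(0,2T))$. $(K_1,K_2)$-cover: a cover $\{B(\mathbf{x}_i,R)\}_{i=1}^n$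 of $B(\mathbf{0},R_0)$, with centers $\mathbf{x}_i\in B(\mathbf{0},R_0)$, is a $(K_1,K_2)$-cover at scale $R$ if $(R_0/R)^3\le n\le K_1(R_0/R)^3$ and any point of $B(\mathbf{0},R_0)$ is covered by at most $K_2$ of the balls $B(\mathbf{x}_i,2R)$. Cut-offs: fix $\psi_0\in\mathcal{D}(B(\mathbf{0},2R_0))$ with $0\le\psi_0\le1$ and $\psi_0=1$ on $B(\mathbf{0},R_0)$; fix $0<\delta\le1$, $C_0>0$ and $\eta\in\mathcal{D}(0,2T)$ with $0\le\eta\le1$, $\eta=1$ on $(T/4,5T/4)$, and $|\eta'|/\eta^\delta\le C_0/T$. Set $\phi_0(t,\mathbf{x})=\eta(t)\psi_0(\mathbf{x})$. For $\mathbf{x}_0\in B(\mathbf{0},R_0)$ and $0<R\le R_0$ let $\phi=\phi_{\mathbf{x}_0,R}=\eta(t)\psi(\mathbf{x})$, where the smooth function $\psi=\psi_{\mathbf{x}_0,R}$ satisfies: (i) if $B(\mathbf{x}_0,R)\subset B(\mathbf{0},R_0)$, then $\psi\in\mathcal{D}(B(\mathbf{x}_0,2R))$, $0\le\psi\le\psi_0$, $\psi=1$ on $B(\mathbf{x}_0,R)$; (ii) if $B(\mathbf{x}_0,R)\not\subset B(\mathbf{0},R_0)$, then $\psi\in\mathcal{D}(B(\mathbf{0},2R_0))$, $0\le\psi\le\psi_0$, $\psi=1$ on $B(\mathbf{x}_0,R)\cap B(\mathbf{0},R_0)$; $\psi=\psi_0$ on the part, between $S(\mathbf{0},R_0)$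 and $S(\mathbf{0},2R_0)$, of the cone centered at $\mathbf{0}$ passing through $S(\mathbf{0},R_0)\cap B(\mathbf{x}_0,R)$; and $\psi=0$ on $B(\mathbf{0},R_0)\setminus B(\mathbf{x}_0,2R)$ and (outside $B(\mathbf{0},R_0)$) outside the part, between $S(\mathbf{0},R_0)$ and $S(\mathbf{0},2R_0)$, of the cone centered at $\mathbf{0}$ passing through $S(\mathbf{0},R_0)\cap B(\mathbf{x}_0,2R)$. In the case $\mathbf{x}_0=\mathbf{0}$, $R=R_0$, one takes $\phi_{\mathbf{0},R_0}=\phi_0$ in the definition of $\varepsilon_{\mathbf{0},R_0}$. Anomalous dissipation: $$\varepsilon_{\mathbf{x}_0,R}=\iint\frac12|\mathbf{u}|^2\partial_t\phi\,d\mathbf{x}\,dt+\iint\Bigl(\frac12|\mathbf{u}|^2+p\Bigr)\mathbf{u}\cdot\nabla\phi\,d\mathbf{x}\,dt\ (\ge0),\qquad \varepsilon_0=\frac1T\frac1{R_0^3}\varepsilon_{\mathbf{0},R_0},$$ where $\varepsilon_{\mathbf{0},R_0}$ is computed with $\phi_0$. For a cover, $$\varepsilon_R=\frac1n\sum_{i=1}^n\frac1T\frac1{R^3}\varepsilon_{\mathbf{x}_i,R},$$ where $\varepsilon_{\mathbf{x}_i,R}$ is computed with $\phi_{\mathbf{x}_i,R}$. *)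

theory Defs
  imports "HOL-Analysis.Analysis"
begin

text \<open>
  A point of space-time is a pair \<open>(x, t)\<close> of type \<open>(real^3) \<times> real\<close>. Balls are open.
\<close>

section \<open>Test functions and local integrability\<close>

primrec Ck :: "nat \<Rightarrow> ('a::real_normed_vector \<Rightarrow> 'b::real_normed_vector) \<Rightarrow> bool" where
  "Ck 0 f \<longleftrightarrow> continuous_on UNIV f"
| "Ck (Suc k) f \<longleftrightarrow>
     (\<forall>x. f differentiable (at x)) \<and> (\<forall>v. Ck k (\<lambda>x. frechet_derivative f (at x) v))"

definition smooth :: "('a::real_normed_vector \<Rightarrow> 'b::real_normed_vector) \<Rightarrow> bool" where
  "smooth f \<longleftrightarrow> (\<forall>k. Ck k f)"

text \<open>The space \<open>\<D>(U)\<close>; its elements are regarded as functions on the whole space, zero off \<open>U\<close>.\<close>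

definition test_functions ::
    "'a::real_normed_vector set \<Rightarrow> ('a \<Rightarrow> 'b::real_normed_vector) set" where
  "test_functions U =
     {f. smooth f \<and> compact (closure {x. f x \<noteq> 0}) \<and> closure {x. f x \<noteq> 0} \<subseteq> U}"

definition Lp_loc ::
    "real \<Rightarrow> 'a::euclidean_space set \<Rightarrow> ('a \<Rightarrow> 'b::euclidean_space) \<Rightarrow> bool" where
  "Lp_loc q U f \<longleftrightarrow>
     f \<in> borel_measurable (lebesgue_on U) \<and>
     (\<forall>C. compact C \<and> C \<subseteq> U \<longrightarrow> integrable (lebesgue_on C) (\<lambda>z. norm (f z) powr q))"


section \<open>Weak solutions of the Euler equations\<close>

definition space_time :: "(real^3) set \<Rightarrow> real \<Rightarrow> ((real^3) \<times> real) set" where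
  "space_time \<Omega> T = \<Omega> \<times> {0<..<2*T}"

definition dt :: "((real^3) \<times> real \<Rightarrow> 'b::real_normed_vector) \<Rightarrow> (real^3) \<times> real \<Rightarrow> 'b" where
  "dt f z = frechet_derivative f (at z) (0, 1)"

text \<open>The spatial directional derivative \<open>(v \<cdot> \<nabla>) f\<close>, which is \<open>v \<cdot> \<nabla>f\<close> for scalar \<open>f\<close>.\<close>

definition dx ::
    "real^3 \<Rightarrow> ((real^3) \<times> real \<Rightarrow> 'b::real_normed_vector) \<Rightarrow> (real^3) \<times> real \<Rightarrow> 'b" where
  "dx v f z = frechet_derivative f (at z) (v, 0)"

definition div_x :: "((real^3) \<times> real \<Rightarrow> real^3) \<Rightarrow> (real^3) \<times> real \<Rightarrow> real" where
  "div_x w z = (\<Sum>b\<in>Basis. dx b w z \<bullet> b)"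

text \<open>
  The nonlinear term is taken in divergence form: \<open>(u \<cdot> \<nabla>) u = div (u \<otimes> u)\<close> because
  \<open>div u = 0\<close>, and tested against \<open>w\<close> it gives \<open>- \<Sum>i j. u\<^sub>i u\<^sub>j \<partial>\<^sub>j w\<^sub>i = - u \<cdot> (u \<cdot> \<nabla>) w\<close>.
\<close>

definition weak_Euler_solution ::
    "(real^3) set \<Rightarrow> real \<Rightarrow> ((real^3) \<times> real \<Rightarrow> real^3) \<Rightarrow> ((real^3) \<times> real \<Rightarrow> real) \<Rightarrow> bool" where
  "weak_Euler_solution \<Omega> T u p \<longleftrightarrow>
     Lp_loc 3 (space_time \<Omega> T) u \<and>
     Lp_loc (3/2) (space_time \<Omega> T) p \<and>
     (\<forall>w :: (real^3) \<times> real \<Rightarrow> real^3. w \<in> test_functions (space_time \<Omega> T) \<longrightarrow>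
        (LINT z : space_time \<Omega> T | lebesgue.
           u z \<bullet> dt w z + u z \<bullet> dx (u z) w z + p z * div_x w z) = 0) \<and>
     (\<forall>\<phi> :: (real^3) \<times> real \<Rightarrow> real. \<phi> \<in> test_functions (space_time \<Omega> T) \<longrightarrow>
        (LINT z : space_time \<Omega> T | lebesgue. dx (u z) \<phi> z) = 0)"

definition dissipation ::
    "(real^3) set \<Rightarrow> real \<Rightarrow> ((real^3) \<times> real \<Rightarrow> real^3) \<Rightarrow> ((real^3) \<times> real \<Rightarrow> real)
      \<Rightarrow> ((real^3) \<times> real \<Rightarrow> real) \<Rightarrow> real" where
  "dissipation \<Omega> T u p \<phi> =
     (LINT z : space_time \<Omega> T | lebesgue. 1/2 * (norm (u z))\<^sup>2 * dt \<phi> z) +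
     (LINT z : space_time \<Omega> T | lebesgue. (1/2 * (norm (u z))\<^sup>2 + p z) * dx (u z) \<phi> z)"

definition local_energy_inequality ::
    "(real^3) set \<Rightarrow> real \<Rightarrow> ((real^3) \<times> real \<Rightarrow> real^3) \<Rightarrow> ((real^3) \<times> real \<Rightarrow> real) \<Rightarrow> bool" where
  "local_energy_inequality \<Omega> T u p \<longleftrightarrow>
     (\<forall>\<phi> \<in> test_functions (space_time \<Omega> T). (\<forall>z. 0 \<le> \<phi> z) \<longrightarrow> 0 \<le> dissipation \<Omega> T u p \<phi>)"


section \<open>Covers and cut-offs\<close>

text \<open>The family of centers is \<open>x 1, \<dots>, x n\<close>; repetitions are allowed and counted.\<close>

definition K_cover ::
    "nat \<Rightarrow> nat \<Rightarrow> real \<Rightarrow> real \<Rightarrow> nat \<Rightarrow> (nat \<Rightarrow> real^3) \<Rightarrow> bool" where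
  "K_cover K1 K2 R0 R n x \<longleftrightarrow>
     (\<forall>i\<in>{1..n}. x i \<in> ball 0 R0) \<and>
     ball 0 R0 \<subseteq> (\<Union>i\<in>{1..n}. ball (x i) R) \<and>
     (R0 / R)^3 \<le> real n \<and> real n \<le> real K1 * (R0 / R)^3 \<and>
     (\<forall>y\<in>ball 0 R0. card {i\<in>{1..n}. y \<in> ball (x i) (2*R)} \<le> K2)"

text \<open>The condition \<open>\<bar>\<eta>'\<bar> / \<eta>\<^sup>\<delta> \<le> C\<^sub>0 / T\<close> is void where \<open>\<eta> = 0\<close> (there \<open>\<eta>' = 0\<close> as \<open>\<eta> \<ge> 0\<close>).\<close>

definition time_cutoff :: "real \<Rightarrow> real \<Rightarrow> real \<Rightarrow> (real \<Rightarrow> real) \<Rightarrow> bool" where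
  "time_cutoff T \<delta> C0 \<eta> \<longleftrightarrow>
     \<eta> \<in> test_functions {0<..<2*T} \<and>
     (\<forall>t. 0 \<le> \<eta> t \<and> \<eta> t \<le> 1) \<and>
     (\<forall>t\<in>{T/4<..<5*T/4}. \<eta> t = 1) \<and>
     (\<forall>t. \<bar>deriv \<eta> t\<bar> / \<eta> t powr \<delta> \<le> C0 / T)"

definition space_cutoff0 :: "real \<Rightarrow> (real^3 \<Rightarrow> real) \<Rightarrow> bool" where
  "space_cutoff0 R0 \<psi>0 \<longleftrightarrow>
     \<psi>0 \<in> test_functions (ball 0 (2*R0)) \<and>
     (\<forall>x. 0 \<le> \<psi>0 x \<and> \<psi>0 x \<le> 1) \<and>
     (\<forall>x\<in>ball 0 R0. \<psi>0 x = 1)"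

text \<open>
  For \<open>A \<subseteq> S(0, R0)\<close>: the part between \<open>S(0, R0)\<close> and \<open>S(0, 2 R0)\<close>, both included, of the cone
  with apex \<open>0\<close> passing through \<open>A\<close>.
\<close>

definition cone_part :: "real \<Rightarrow> (real^3) set \<Rightarrow> (real^3) set" where
  "cone_part R0 A = {s *\<^sub>R y | s y. y \<in> A \<and> 0 \<le> s \<and> R0 \<le> norm (s *\<^sub>R y) \<and> norm (s *\<^sub>R y) \<le> 2*R0}"

definition space_cutoff ::
    "real \<Rightarrow> (real^3 \<Rightarrow> real) \<Rightarrow> real^3 \<Rightarrow> real \<Rightarrow> (real^3 \<Rightarrow> real) \<Rightarrow> bool" where
  "space_cutoff R0 \<psi>0 x0 R \<psi> \<longleftrightarrow>
     (if ball x0 R \<subseteq> ball 0 R0 then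
        \<psi> \<in> test_functions (ball x0 (2*R)) \<and>
        (\<forall>x. 0 \<le> \<psi> x \<and> \<psi> x \<le> \<psi>0 x) \<and>
        (\<forall>x\<in>ball x0 R. \<psi> x = 1)
      else
        \<psi> \<in> test_functions (ball 0 (2*R0)) \<and>
        (\<forall>x. 0 \<le> \<psi> x \<and> \<psi> x \<le> \<psi>0 x) \<and>
        (\<forall>x \<in> ball x0 R \<inter> ball 0 R0. \<psi> x = 1) \<and>
        (\<forall>x \<in> cone_part R0 (sphere 0 R0 \<inter> ball x0 R). \<psi> x = \<psi>0 x) \<and>
        (\<forall>x \<in> ball 0 R0 - ball x0 (2*R). \<psi> x = 0) \<and>
        (\<forall>x. x \<notin> ball 0 R0 \<and> x \<notin> cone_part R0 (sphere 0 R0 \<inter> ball x0 (2*R)) \<longrightarrow> \<psi> x = 0))"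

text \<open>
  The last condition is the convention \<open>\<phi>\<close> = \<open>\<phi>0\<close> for the center \<open>0\<close> and the scale \<open>R0\<close>.
\<close>

definition space_cutoff_family ::
    "real \<Rightarrow> (real^3 \<Rightarrow> real) \<Rightarrow> (real^3 \<Rightarrow> real \<Rightarrow> real^3 \<Rightarrow> real) \<Rightarrow> bool" where
  "space_cutoff_family R0 \<psi>0 \<psi> \<longleftrightarrow>
     (\<forall>x0\<in>ball 0 R0. \<forall>R. 0 < R \<and> R \<le> R0 \<longrightarrow> space_cutoff R0 \<psi>0 x0 R (\<psi> x0 R)) \<and>
     \<psi> 0 R0 = \<psi>0"

definition cutoff :: "(real \<Rightarrow> real) \<Rightarrow> (real^3 \<Rightarrow> real) \<Rightarrow> (real^3) \<times> real \<Rightarrow> real" where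
  "cutoff \<eta> \<psi> = (\<lambda>(x, t). \<eta> t * \<psi> x)"


section \<open>Anomalous dissipation\<close>

definition eps0 ::
    "(real^3) set \<Rightarrow> real \<Rightarrow> ((real^3) \<times> real \<Rightarrow> real^3) \<Rightarrow> ((real^3) \<times> real \<Rightarrow> real)
      \<Rightarrow> (real \<Rightarrow> real) \<Rightarrow> (real^3 \<Rightarrow> real) \<Rightarrow> real \<Rightarrow> real" where
  "eps0 \<Omega> T u p \<eta> \<psi>0 R0 = 1 / T * (1 / R0^3) * dissipation \<Omega> T u p (cutoff \<eta> \<psi>0)"

definition epsR ::
    "(real^3) set \<Rightarrow> real \<Rightarrow> ((real^3) \<times> real \<Rightarrow> real^3) \<Rightarrow> ((real^3) \<times> real \<Rightarrow> real)
      \<Rightarrow> (real \<Rightarrow> real) \<Rightarrow> (real^3 \<Rightarrow> real \<Rightarrow> real^3 \<Rightarrow> real)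
      \<Rightarrow> real \<Rightarrow> nat \<Rightarrow> (nat \<Rightarrow> real^3) \<Rightarrow> real" where
  "epsR \<Omega> T u p \<eta> \<psi> R n x =
     1 / real n *
       (\<Sum>i=1..n. 1 / T * (1 / R^3) * dissipation \<Omega> T u p (cutoff \<eta> (\<psi> (x i) R)))"

end

theory Submission
  imports Defs
begin

text \<open>
  The dissipation \<open>D(\<phi>)\<close> is a linear functional of the test function \<open>\<phi>\<close>, and the local energy
  inequality says exactly that it is nonnegative on nonnegative test functions. Hence it is monotone,
  and everything reduces to a pointwise comparison of the cut-offs,
  \<open>\<psi>\<^sub>0 \<le> \<Sum>\<^sub>i \<psi>\<^sub>i \<le> K2 \<psi>\<^sub>0\<close>, where \<open>\<psi>\<^sub>i\<close> belongs to the \<open>i\<close>-th ball of the cover.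
  Multiplying by \<open>\<eta>\<close> and applying \<open>D\<close> gives \<open>D(\<phi>\<^sub>0) \<le> \<Sum>\<^sub>i D(\<phi>\<^sub>i) \<le> K2 D(\<phi>\<^sub>0)\<close>; since
  \<open>R0\<^sup>3 \<le> n R\<^sup>3 \<le> K1 R0\<^sup>3\<close>, the averages compare with the constant \<open>K = K1 + K2\<close>. That
  \<open>D\<close> is additive rests on the convergence of the integrals that define it, which follows from
  \<open>u \<in> L\<^sup>3\<close> and \<open>p \<in> L\<^sup>3\<^sup>/\<^sup>2\<close> locally (\<open>dissipation_integrands_integrable\<close>, \<open>dissipation_lincomb\<close>,
  \<open>dissipation_mono\<close>).

  The upper bound (\<open>sum_cutoffs_le\<close>) is a count. Let \<open>y\<close> be the nearest point to \<open>z\<close> in the closed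
  ball of radius \<open>R0\<close>. If \<open>\<psi>\<^sub>i(z) \<noteq> 0\<close> then \<open>y\<close> lies in the ball of radius \<open>2R\<close> about \<open>x\<^sub>i\<close>
  (\<open>space_cutoff_support\<close>), and at most \<open>K2\<close> of these balls contain \<open>y\<close>.

  In the lower bound (\<open>le_sum_cutoffs\<close>), a point inside the ball of radius \<open>R0\<close> lies in some ball of
  the cover, where \<open>\<psi>\<^sub>i = 1\<close>. A point outside it is dealt with by its radial projection to the sphere:
  if this lies in the \<open>i\<close>-th ball then \<open>\<psi>\<^sub>i = \<psi>\<^sub>0\<close> on the ray. The difficulty is that the open balls
  cover only the open ball of radius \<open>R0\<close>, so that a point of the sphere may lie on the boundary of
  the covering balls and in none of them. The rays through such points are contained in a finite
  union of circular cones, which has empty interior, and the inequality extends over it by continuity. The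
  only degenerate cone, with \<open>x\<^sub>i = 0\<close> and \<open>R = R0\<close>, is excluded by the convention that \<open>\<psi>\<^sub>i = \<psi>\<^sub>0\<close>
  in this case.
\<close>

section \<open>Calculus of test functions\<close>

text \<open>
  Inductive proofs that \<open>Ck\<close> is preserved by an operation need only the formula that the operation
  has for derivatives; this rule spares them the choice operator inside \<open>frechet_derivative\<close>.
\<close>

lemma Ck_SucI:
  assumes "\<And>x. (f has_derivative f' x) (at x)" and "\<And>v. Ck k (\<lambda>x. f' x v)"
  shows "Ck (Suc k) f"
proof -
  have "frechet_derivative f (at x) = f' x" for x
    using frechet_derivative_at[OF assms(1)] by simp
  then show ?thesis
    using assms by (auto simp: differentiable_def)
qed

lemma Ck_Suc_has_derivative:
  assumes "Ck (Suc k) f"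
  shows "(f has_derivative frechet_derivative f (at x)) (at x)"
  using assms by (simp add: frechet_derivative_works)

lemma Ck_Suc_imp_Ck: "Ck (Suc k) f \<Longrightarrow> Ck k f"
proof (induction k arbitrary: f)
  case 0
  then show ?case
    by (auto intro!: continuous_at_imp_continuous_on differentiable_imp_continuous_within)
next
  case (Suc k)
  have "Ck k (\<lambda>x. frechet_derivative f (at x) v)" for v
    using Suc.IH[of "\<lambda>x. frechet_derivative f (at x) v"] Suc.prems by simp
  then show ?case
    using Suc.prems by simp
qed

lemma Ck_const: "Ck k (\<lambda>x. c)"
proof (induction k arbitrary: c)
  case (Suc k)
  show ?case
    by (rule Ck_SucI[OF has_derivative_const Suc.IH])
qed simp

lemma Ck_add: "Ck k f \<Longrightarrow> Ck k g \<Longrightarrow> Ck k (\<lambda>x. f x + g x)"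
proof (induction k arbitrary: f g)
  case (Suc k)
  show ?case
    by (rule Ck_SucI[OF has_derivative_add[OF Suc.prems[THEN Ck_Suc_has_derivative]]])
       (use Suc in auto)
qed (auto intro: continuous_on_add)

lemma Ck_mult:
  fixes f g :: "'a::real_normed_vector \<Rightarrow> 'b::real_normed_algebra"
  shows "Ck k f \<Longrightarrow> Ck k g \<Longrightarrow> Ck k (\<lambda>x. f x * g x)"
proof (induction k arbitrary: f g)
  case (Suc k)
  show ?case
    by (rule Ck_SucI[OF has_derivative_mult[OF Suc.prems[THEN Ck_Suc_has_derivative]]],
        intro Ck_add Suc.IH Suc.prems[THEN Ck_Suc_imp_Ck])
       (use Suc.prems in auto)
qed (auto intro: continuous_on_mult)

lemma Ck_compose_bounded_linear:
  assumes L: "bounded_linear L"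
  shows "Ck k f \<Longrightarrow> Ck k (\<lambda>x. f (L x))"
proof (induction k arbitrary: f)
  case 0
  then show ?case
    by (auto intro: continuous_on_compose2 linear_continuous_on[OF L])
next
  case (Suc k)
  show ?case
    by (rule Ck_SucI[OF has_derivative_compose[OF bounded_linear_imp_has_derivative[OF L]
              Ck_Suc_has_derivative[OF Suc.prems]]])
       (use Suc in auto)
qed

lemma test_functionsI:
  assumes "smooth f" and "{x. f x \<noteq> 0} \<subseteq> C" and "compact C" and "C \<subseteq> U"
  shows "f \<in> test_functions U"
proof -
  have "closure {x. f x \<noteq> 0} \<subseteq> C"
    using assms by (simp add: closure_minimal compact_imp_closed)
  then have "compact (closure {x. f x \<noteq> 0})"
    using compact_Int_closed[OF \<open>compact C\<close> closed_closure, of "{x. f x \<noteq> 0}"]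
    by (simp add: Int_absorb1)
  then show ?thesis
    using assms \<open>closure {x. f x \<noteq> 0} \<subseteq> C\<close> by (auto simp: test_functions_def)
qed

lemma test_functionsE:
  assumes "f \<in> test_functions U"
  obtains C where "smooth f" "{x. f x \<noteq> 0} \<subseteq> C" "compact C" "C \<subseteq> U"
  using assms that[of "closure {x. f x \<noteq> 0}"] closure_subset[of "{x. f x \<noteq> 0}"]
  unfolding test_functions_def by blast

lemma test_functions_lincomb:
  fixes f g :: "'a::real_normed_vector \<Rightarrow> real"
  assumes "f \<in> test_functions U" and "g \<in> test_functions U"
  shows "(\<lambda>x. a * f x + b * g x) \<in> test_functions U"
proof -
  obtain C where C: "smooth f" "{x. f x \<noteq> 0} \<subseteq> C" "compact C" "C \<subseteq> U"
    using assms(1) by (rule test_functionsE)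
  obtain D where D: "smooth g" "{x. g x \<noteq> 0} \<subseteq> D" "compact D" "D \<subseteq> U"
    using assms(2) by (rule test_functionsE)
  show ?thesis
  proof (rule test_functionsI)
    show "smooth (\<lambda>x. a * f x + b * g x)"
      using C(1) D(1) unfolding smooth_def by (intro allI Ck_add Ck_mult Ck_const) blast+
    show "{x. a * f x + b * g x \<noteq> 0} \<subseteq> C \<union> D"
    proof
      fix x assume "x \<in> {x. a * f x + b * g x \<noteq> 0}"
      then have "f x \<noteq> 0 \<or> g x \<noteq> 0"
        by auto
      then show "x \<in> C \<union> D"
        using C(2) D(2) by blast
    qed
  qed (use C D in auto)
qed

lemma test_functions_zero: "(\<lambda>x. 0) \<in> test_functions U"
  by (rule test_functionsI[of _ "{}"]) (auto simp: smooth_def Ck_const)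

lemma test_functions_sum:
  fixes f :: "'i \<Rightarrow> 'a::real_normed_vector \<Rightarrow> real"
  assumes "\<And>i. i \<in> A \<Longrightarrow> f i \<in> test_functions U"
  shows "(\<lambda>x. \<Sum>i\<in>A. f i x) \<in> test_functions U"
  using assms
proof (induction A rule: infinite_finite_induct)
  case (insert i A)
  then show ?case
    using test_functions_lincomb[of "f i" U "\<lambda>x. \<Sum>i\<in>A. f i x" 1 1] by simp
qed (simp_all add: test_functions_zero)

lemma cutoff_test_functions:
  assumes "\<eta> \<in> test_functions {0<..<2*T}" and "\<psi> \<in> test_functions \<Omega>"
  shows "cutoff \<eta> \<psi> \<in> test_functions (space_time \<Omega> T)"
proof -
  obtain C where C: "smooth \<eta>" "{x. \<eta> x \<noteq> 0} \<subseteq> C" "compact C" "C \<subseteq> {0<..<2*T}"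
    using assms(1) by (rule test_functionsE)
  obtain D where D: "smooth \<psi>" "{x. \<psi> x \<noteq> 0} \<subseteq> D" "compact D" "D \<subseteq> \<Omega>"
    using assms(2) by (rule test_functionsE)
  show ?thesis
  proof (rule test_functionsI)
    show "smooth (cutoff \<eta> \<psi>)"
      using C(1) D(1) unfolding smooth_def cutoff_def case_prod_beta
      by (intro allI Ck_mult Ck_compose_bounded_linear[OF bounded_linear_fst]
          Ck_compose_bounded_linear[OF bounded_linear_snd]) blast+
    show "{z. cutoff \<eta> \<psi> z \<noteq> 0} \<subseteq> D \<times> C"
      using C(2) D(2) by (auto simp: cutoff_def subset_iff)
    show "compact (D \<times> C)"
      by (intro compact_Times C D)
    show "D \<times> C \<subseteq> space_time \<Omega> T"
      unfolding space_time_def by (intro Sigma_mono C D)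
  qed
qed

lemma test_function_has_derivative:
  assumes "f \<in> test_functions U"
  shows "(f has_derivative frechet_derivative f (at x)) (at x)"
proof -
  have "Ck (Suc 0) f"
    using assms unfolding test_functions_def smooth_def by blast
  then show ?thesis
    by (rule Ck_Suc_has_derivative)
qed

lemma test_function_derivative_continuous:
  assumes "f \<in> test_functions U"
  shows "continuous_on A (\<lambda>x. frechet_derivative f (at x) v)"
proof -
  have "Ck (Suc 0) f"
    using assms by (auto simp: test_functions_def smooth_def)
  then show ?thesis
    by (auto intro: continuous_on_subset)
qed

lemma derivative_zero_off_support:
  assumes "{x. f x \<noteq> 0} \<subseteq> C" and "closed C" and "x \<notin> C"
  shows "frechet_derivative f (at x) v = 0"
proof -
  have "((\<lambda>x. 0) has_derivative (\<lambda>v. 0)) (at x)"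
    by (rule has_derivative_const)
  then have "(f has_derivative (\<lambda>v. 0)) (at x)"
    by (rule has_derivative_transform_within_open[of _ _ _ _ "- C"]) (use assms in auto)
  then show ?thesis
    using frechet_derivative_at by metis
qed

lemma frechet_derivative_lincomb:
  fixes f g :: "'a::real_normed_vector \<Rightarrow> real"
  assumes "f \<in> test_functions U" and "g \<in> test_functions U"
  shows "frechet_derivative (\<lambda>x. a * f x + b * g x) (at x) v =
    a * frechet_derivative f (at x) v + b * frechet_derivative g (at x) v"
proof -
  have "((\<lambda>x. a * f x + b * g x) has_derivative
      (\<lambda>v. a * frechet_derivative f (at x) v + b * frechet_derivative g (at x) v)) (at x)"
    by (intro has_derivative_add has_derivative_mult_right
        test_function_has_derivative[OF assms(1)] test_function_has_derivative[OF assms(2)])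
  from frechet_derivative_at[OF this, symmetric] show ?thesis
    by simp
qed


section \<open>Dissipation as a positive linear functional\<close>

lemma Lp_loc_measurable_compact:
  assumes "Lp_loc q U f" and "C \<subseteq> U"
  shows "f \<in> borel_measurable (lebesgue_on C)"
  using assms(1) measurable_restrict_mono[OF _ assms(2)] unfolding Lp_loc_def by blast

lemma Lp_loc_integrable_powr:
  assumes "Lp_loc q U f" and "compact C" and "C \<subseteq> U"
  shows "integrable (lebesgue_on C) (\<lambda>z. norm (f z) powr q)"
  using assms unfolding Lp_loc_def by blast

lemma integrable_const_compact:
  assumes "compact (C :: 'a::euclidean_space set)"
  shows "integrable (lebesgue_on C) (\<lambda>z. c :: real)"
  using assms by (intro finite_measure.integrable_const finite_measure_lebesgue_on lmeasurable_compact)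

text \<open>
  On a compact set \<open>L\<^sup>3\<close> is contained in \<open>L\<^sup>2\<close>, the measure being finite.
\<close>

lemma integrable_energy_density:
  fixes u :: "'a::euclidean_space \<Rightarrow> 'b::euclidean_space"
  assumes u: "Lp_loc 3 U u" and C: "compact C" "C \<subseteq> U"
  shows "integrable (lebesgue_on C) (\<lambda>z. 1/2 * (norm (u z))\<^sup>2)"
proof (rule Bochner_Integration.integrable_bound)
  show "integrable (lebesgue_on C) (\<lambda>z. 1 + norm (u z) powr 3)"
    by (intro Bochner_Integration.integrable_add integrable_const_compact
        Lp_loc_integrable_powr[OF u] C)
  have [measurable]: "u \<in> borel_measurable (lebesgue_on C)"
    by (rule Lp_loc_measurable_compact[OF u C(2)])
  show "(\<lambda>z. 1/2 * (norm (u z))\<^sup>2) \<in> borel_measurable (lebesgue_on C)"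
    by measurable
  have "1/2 * a\<^sup>2 \<le> 1 + a powr 3" if "a \<ge> 0" for a :: real
  proof (cases "a \<le> 1")
    case True
    then have "a\<^sup>2 \<le> 1"
      using that by (simp add: power_le_one)
    then show ?thesis
      using powr_ge_zero[of a 3] by linarith
  next
    case False
    then have "a\<^sup>2 \<le> a ^ 3"
      by (intro power_increasing) auto
    moreover have "a powr 3 = a ^ 3"
      using False by (simp add: powr_numeral)
    ultimately show ?thesis
      using zero_le_power2[of a] by linarith
  qed
  then show "AE z in lebesgue_on C. norm (1/2 * (norm (u z))\<^sup>2) \<le> norm (1 + norm (u z) powr 3)"
    by (intro AE_I2) simp
qed

text \<open>
  A crude form of Young's inequality for the dual exponents \<open>3\<close> and \<open>3/2\<close>: with \<open>q = \<surd>b\<close> the left-hand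
  side is \<open>q\<^sup>2 a\<close>, which is at most the cube of the larger of \<open>a\<close> and \<open>q\<close>.
\<close>

lemma product_le_sum_of_powers:
  fixes a b :: real
  assumes "a \<ge> 0" and "b \<ge> 0"
  shows "b * a \<le> a powr 3 + b powr (3/2)"
proof -
  define q where "q = sqrt b"
  have q: "q \<ge> 0" "b = q\<^sup>2"
    using assms by (auto simp: q_def)
  have "b powr (3/2) = q ^ 3"
  proof (cases "b = 0")
    case False
    then have "q ^ 3 = (b powr (1/2)) powr 3"
      using assms by (simp add: q_def powr_half_sqrt powr_numeral)
    also have "\<dots> = b powr (3/2)"
      by (simp add: powr_powr)
    finally show ?thesis
      by simp
  qed (simp add: q_def)
  moreover have "q\<^sup>2 * a \<le> a ^ 3 + q ^ 3"
  proof (cases "a \<le> q")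
    case True
    then have "q\<^sup>2 * a \<le> q\<^sup>2 * q"
      by (simp add: mult_left_mono)
    then show ?thesis
      using assms by (simp add: power3_eq_cube power2_eq_square add_increasing)
  next
    case False
    then have "q\<^sup>2 * a \<le> a\<^sup>2 * a"
      using q assms by (intro mult_right_mono power_mono) auto
    then show ?thesis
      using q by (simp add: power3_eq_cube power2_eq_square add_increasing2)
  qed
  moreover have "a powr 3 = a ^ 3"
    using assms by (cases "a = 0") (simp_all add: powr_numeral)
  ultimately show ?thesis
    using q by simp
qed

lemma integrable_energy_flux:
  fixes u :: "'a::euclidean_space \<Rightarrow> 'b::euclidean_space" and p :: "'a \<Rightarrow> real"
  assumes u: "Lp_loc 3 U u" and p: "Lp_loc (3/2) U p" and C: "compact C" "C \<subseteq> U"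
  shows "integrable (lebesgue_on C) (\<lambda>z. (1/2 * (norm (u z))\<^sup>2 + p z) * (u z \<bullet> v))"
proof (rule Bochner_Integration.integrable_bound)
  let ?b = "\<lambda>z. norm v * (2 * norm (u z) powr 3 + norm (p z) powr (3/2))"
  show "integrable (lebesgue_on C) ?b"
    by (intro Bochner_Integration.integrable_add integrable_mult_right
        Lp_loc_integrable_powr[OF u] Lp_loc_integrable_powr[OF p] C)
  have [measurable]: "u \<in> borel_measurable (lebesgue_on C)" "p \<in> borel_measurable (lebesgue_on C)"
    using Lp_loc_measurable_compact[OF u C(2)] Lp_loc_measurable_compact[OF p C(2)] by auto
  show "(\<lambda>z. (1/2 * (norm (u z))\<^sup>2 + p z) * (u z \<bullet> v)) \<in> borel_measurable (lebesgue_on C)"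
    by measurable
  have "norm ((1/2 * (norm (u z))\<^sup>2 + p z) * (u z \<bullet> v)) \<le> norm (?b z)" for z
  proof -
    let ?a = "norm (u z)"
    have "\<bar>1/2 * ?a\<^sup>2 + p z\<bar> * \<bar>u z \<bullet> v\<bar> \<le> (1/2 * ?a\<^sup>2 + \<bar>p z\<bar>) * (?a * norm v)"
      by (intro mult_mono Cauchy_Schwarz_ineq2) (auto intro: order_trans[OF abs_triangle_ineq])
    also have "\<dots> = norm v * (1/2 * ?a ^ 3 + \<bar>p z\<bar> * ?a)"
      by (simp add: algebra_simps power2_eq_square power3_eq_cube)
    also have "\<dots> \<le> norm v * (2 * ?a powr 3 + \<bar>p z\<bar> powr (3/2))"
    proof -
      have "?a powr 3 = ?a ^ 3"
        by (cases "?a = 0") (simp_all add: powr_numeral)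
      moreover have "\<bar>p z\<bar> * ?a \<le> ?a powr 3 + \<bar>p z\<bar> powr (3/2)"
        by (rule product_le_sum_of_powers) auto
      ultimately have "1/2 * ?a ^ 3 + \<bar>p z\<bar> * ?a \<le> 2 * ?a powr 3 + \<bar>p z\<bar> powr (3/2)"
        using powr_ge_zero[of ?a 3] by linarith
      then show ?thesis
        by (rule mult_left_mono) simp
    qed
    finally show ?thesis
      by (simp add: abs_mult)
  qed
  then show "AE z in lebesgue_on C. norm ((1/2 * (norm (u z))\<^sup>2 + p z) * (u z \<bullet> v)) \<le> norm (?b z)"
    by (intro AE_I2)
qed

text \<open>
  The derivative is continuous and vanishes off a compact subset \<open>C\<close> of \<open>U\<close>, so that the integral is
  really over \<open>C\<close>, where one factor is integrable and the other one bounded.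
\<close>

lemma set_integrable_times_test_function_derivative:
  fixes h :: "'a::euclidean_space \<Rightarrow> real" and \<phi> :: "'a \<Rightarrow> real"
  assumes h: "\<And>C. compact C \<Longrightarrow> C \<subseteq> U \<Longrightarrow> integrable (lebesgue_on C) h"
    and \<phi>: "\<phi> \<in> test_functions U"
  shows "set_integrable lebesgue U (\<lambda>z. h z * frechet_derivative \<phi> (at z) v)"
proof -
  let ?d = "\<lambda>z. frechet_derivative \<phi> (at z) v"
  obtain C where C: "{x. \<phi> x \<noteq> 0} \<subseteq> C" "compact C" "C \<subseteq> U"
    using \<phi> by (rule test_functionsE)
  have zero: "?d z = 0" if "z \<notin> C" for z
    using derivative_zero_off_support C that compact_imp_closed by blast
  have cont: "continuous_on A ?d" for A
    by (rule test_function_derivative_continuous[OF \<phi>])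
  obtain M where M: "\<And>z. z \<in> C \<Longrightarrow> \<bar>?d z\<bar> \<le> M"
    using compact_imp_bounded[OF compact_continuous_image[OF cont C(2)]]
    by (auto simp: bounded_iff)
  have Cs: "C \<in> sets lebesgue"
    using C(2) by (simp add: lmeasurable_compact fmeasurableD)
  have "integrable (lebesgue_on C) (\<lambda>z. h z * ?d z)"
  proof (rule Bochner_Integration.integrable_bound)
    show "integrable (lebesgue_on C) (\<lambda>z. M * h z)"
      using h[OF C(2,3)] by simp
    have [measurable]: "h \<in> borel_measurable (lebesgue_on C)"
      using h[OF C(2,3)] by blast
    have [measurable]: "?d \<in> borel_measurable (lebesgue_on C)"
      by (rule continuous_imp_measurable_on_sets_lebesgue[OF cont Cs])
    show "(\<lambda>z. h z * ?d z) \<in> borel_measurable (lebesgue_on C)"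
      by measurable
    have "norm (h z * ?d z) \<le> norm (M * h z)" if "z \<in> C" for z
    proof -
      have "\<bar>h z\<bar> * \<bar>?d z\<bar> \<le> \<bar>h z\<bar> * \<bar>M\<bar>"
        using M[OF that] by (intro mult_left_mono) auto
      then show ?thesis
        by (simp add: abs_mult mult.commute)
    qed
    then show "AE z in lebesgue_on C. norm (h z * ?d z) \<le> norm (M * h z)"
      by (intro AE_I2) simp
  qed
  then have "set_integrable lebesgue C (\<lambda>z. h z * ?d z)"
    using Cs by (simp add: integrable_restrict_space set_integrable_def)
  moreover have "indicator U z *\<^sub>R (h z * ?d z) = indicator C z *\<^sub>R (h z * ?d z)" for z
    using zero[of z] C(3) by (auto simp: indicator_def)
  ultimately show ?thesis
    unfolding set_integrable_def by presburger
qed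

text \<open>
  Expanding the directional derivative separates the merely measurable field \<open>u\<close> from the continuous
  derivatives of the test function.
\<close>

lemma dx_eq_sum_Basis:
  fixes \<phi> :: "(real^3) \<times> real \<Rightarrow> real"
  assumes "\<phi> \<in> test_functions U"
  shows "dx v \<phi> z = (\<Sum>b\<in>Basis. (v \<bullet> b) * dx b \<phi> z)"
proof -
  have lin: "linear (\<lambda>w. frechet_derivative \<phi> (at z) (w, 0))"
  proof (rule linear_compose[of "\<lambda>w. (w, 0)", unfolded o_def])
    show "linear (\<lambda>w::real^3. (w, 0::real))"
      by (rule linearI) auto
    show "linear (frechet_derivative \<phi> (at z))"
      by (rule has_derivative_linear[OF test_function_has_derivative[OF assms]])
  qed
  have "dx v \<phi> z = frechet_derivative \<phi> (at z) (\<Sum>b\<in>Basis. (v \<bullet> b) *\<^sub>R b, 0)"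
    by (simp add: dx_def euclidean_representation)
  also have "\<dots> = (\<Sum>b\<in>Basis. (v \<bullet> b) * dx b \<phi> z)"
    using linear_sum[OF lin, of "\<lambda>b. (v \<bullet> b) *\<^sub>R b" Basis] linear_scale[OF lin]
    by (simp add: dx_def)
  finally show ?thesis .
qed

lemma dissipation_integrands_integrable:
  assumes u: "Lp_loc 3 (space_time \<Omega> T) u" and p: "Lp_loc (3/2) (space_time \<Omega> T) p"
    and \<phi>: "\<phi> \<in> test_functions (space_time \<Omega> T)"
  shows "set_integrable lebesgue (space_time \<Omega> T) (\<lambda>z. 1/2 * (norm (u z))\<^sup>2 * dt \<phi> z)"
    and "set_integrable lebesgue (space_time \<Omega> T)
           (\<lambda>z. (1/2 * (norm (u z))\<^sup>2 + p z) * dx (u z) \<phi> z)"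
proof -
  show "set_integrable lebesgue (space_time \<Omega> T) (\<lambda>z. 1/2 * (norm (u z))\<^sup>2 * dt \<phi> z)"
    unfolding dt_def
    by (rule set_integrable_times_test_function_derivative[OF integrable_energy_density[OF u] \<phi>])
  have "set_integrable lebesgue (space_time \<Omega> T)
      (\<lambda>z. ((1/2 * (norm (u z))\<^sup>2 + p z) * (u z \<bullet> b)) * dx b \<phi> z)" for b
    unfolding dx_def
    by (rule set_integrable_times_test_function_derivative[OF integrable_energy_flux[OF u p] \<phi>])
  then have "set_integrable lebesgue (space_time \<Omega> T)
      (\<lambda>z. \<Sum>b\<in>Basis. ((1/2 * (norm (u z))\<^sup>2 + p z) * (u z \<bullet> b)) * dx b \<phi> z)"
    unfolding set_integrable_def scaleR_sum_right by (rule Bochner_Integration.integrable_sum)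
  then show "set_integrable lebesgue (space_time \<Omega> T)
           (\<lambda>z. (1/2 * (norm (u z))\<^sup>2 + p z) * dx (u z) \<phi> z)"
    by (subst dx_eq_sum_Basis[OF \<phi>]) (simp add: sum_distrib_left mult.assoc)
qed

context
  fixes \<Omega> :: "(real^3) set" and T :: real
    and u :: "(real^3) \<times> real \<Rightarrow> real^3" and p :: "(real^3) \<times> real \<Rightarrow> real"
  assumes u: "Lp_loc 3 (space_time \<Omega> T) u" and p: "Lp_loc (3/2) (space_time \<Omega> T) p"
begin

lemma dissipation_lincomb:
  assumes f: "f \<in> test_functions (space_time \<Omega> T)" and g: "g \<in> test_functions (space_time \<Omega> T)"
  shows "dissipation \<Omega> T u p (\<lambda>z. a * f z + b * g z) =
    a * dissipation \<Omega> T u p f + b * dissipation \<Omega> T u p g"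
proof -
  note integrable = dissipation_integrands_integrable[OF u p]
  have *: "(LINT z : S | lebesgue. a * F z + b * G z) =
      a * (LINT z : S | lebesgue. F z) + b * (LINT z : S | lebesgue. G z)"
    if "set_integrable lebesgue S F" "set_integrable lebesgue S G"
    for S and F G :: "(real^3) \<times> real \<Rightarrow> real"
    by (subst set_integral_add(2))
       (use that in \<open>auto intro!: set_integrable_mult_right simp only: set_integral_mult_right\<close>)
  have 1: "(LINT z : space_time \<Omega> T | lebesgue. 1/2 * (norm (u z))\<^sup>2 * dt (\<lambda>z. a * f z + b * g z) z) =
      a * (LINT z : space_time \<Omega> T | lebesgue. 1/2 * (norm (u z))\<^sup>2 * dt f z) +
      b * (LINT z : space_time \<Omega> T | lebesgue. 1/2 * (norm (u z))\<^sup>2 * dt g z)"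
  proof -
    have "k * dt (\<lambda>z. a * f z + b * g z) z = a * (k * dt f z) + b * (k * dt g z)" for k z
      unfolding dt_def frechet_derivative_lincomb[OF f g] by (simp only: distrib_left mult.left_commute)
    then show ?thesis
      by (simp only: *[OF integrable(1)[OF f] integrable(1)[OF g]])
  qed
  have 2: "(LINT z : space_time \<Omega> T | lebesgue.
        (1/2 * (norm (u z))\<^sup>2 + p z) * dx (u z) (\<lambda>z. a * f z + b * g z) z) =
      a * (LINT z : space_time \<Omega> T | lebesgue. (1/2 * (norm (u z))\<^sup>2 + p z) * dx (u z) f z) +
      b * (LINT z : space_time \<Omega> T | lebesgue. (1/2 * (norm (u z))\<^sup>2 + p z) * dx (u z) g z)"
  proof -
    have "k * dx v (\<lambda>z. a * f z + b * g z) z = a * (k * dx v f z) + b * (k * dx v g z)" for k v z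
      unfolding dx_def frechet_derivative_lincomb[OF f g] by (simp only: distrib_left mult.left_commute)
    then show ?thesis
      by (simp only: *[OF integrable(2)[OF f] integrable(2)[OF g]])
  qed
  show ?thesis
    unfolding dissipation_def 1 2 by (simp only: distrib_left add_ac)
qed

lemma dissipation_scale:
  assumes "f \<in> test_functions (space_time \<Omega> T)"
  shows "dissipation \<Omega> T u p (\<lambda>z. a * f z) = a * dissipation \<Omega> T u p f"
  using dissipation_lincomb[OF assms assms, of a 0] by simp

lemma dissipation_sum:
  assumes "finite A" and "\<And>i. i \<in> A \<Longrightarrow> f i \<in> test_functions (space_time \<Omega> T)"
  shows "dissipation \<Omega> T u p (\<lambda>z. \<Sum>i\<in>A. f i z) = (\<Sum>i\<in>A. dissipation \<Omega> T u p (f i))"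
  using assms
proof (induction A rule: finite_induct)
  case empty
  show ?case
    using dissipation_scale[OF test_functions_zero, of 0] by simp
next
  case (insert i A)
  then show ?case
    using dissipation_lincomb[OF _ test_functions_sum, of "f i" A f 1 1] by simp
qed

text \<open>
  The local energy inequality is used here, for the nonnegative test function \<open>g - f\<close>.
\<close>

lemma dissipation_mono:
  assumes energy: "local_energy_inequality \<Omega> T u p"
    and f: "f \<in> test_functions (space_time \<Omega> T)" and g: "g \<in> test_functions (space_time \<Omega> T)"
    and le: "\<And>z. f z \<le> g z"
  shows "dissipation \<Omega> T u p f \<le> dissipation \<Omega> T u p g"
proof -
  let ?h = "\<lambda>z. 1 * g z + (- 1) * f z"
  have "?h \<in> test_functions (space_time \<Omega> T)"
    by (rule test_functions_lincomb[OF g f])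
  moreover have "\<forall>z. 0 \<le> ?h z"
    using le by simp
  ultimately have "0 \<le> dissipation \<Omega> T u p ?h"
    using energy unfolding local_energy_inequality_def by (elim ballE impE) auto
  also have "\<dots> = 1 * dissipation \<Omega> T u p g + (- 1) * dissipation \<Omega> T u p f"
    by (rule dissipation_lincomb[OF g f])
  finally show ?thesis
    by simp
qed

end


section \<open>Overlap of the cut-offs\<close>

text \<open>
  The radial projection \<open>y\<close> of \<open>z\<close> is its nearest point in the closed ball of radius \<open>r\<close>. With
  \<open>z = l y\<close>, \<open>l \<ge> 1\<close>, the difference of the squared distances to \<open>x0\<close> is
  \<open>(l - 1) ((l - 1) r\<^sup>2 + 2 (r\<^sup>2 - x0 \<bullet> y))\<close>, and \<open>x0 \<bullet> y \<le> r\<^sup>2\<close>.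
\<close>

lemma radial_retraction_closer:
  fixes z x0 :: "'a::real_inner"
  assumes "0 < r" and "r \<le> norm z" and "norm x0 \<le> r"
  shows "dist x0 ((r / norm z) *\<^sub>R z) \<le> dist x0 z"
proof -
  define y where "y = (r / norm z) *\<^sub>R z"
  define l where "l = norm z / r"
  have "norm z \<noteq> 0"
    using assms by linarith
  then have l: "l \<ge> 1" and z: "z = l *\<^sub>R y" and y: "norm y = r"
    using assms(1,2) by (simp_all add: y_def l_def)
  have yx: "x0 \<bullet> y \<le> r\<^sup>2"
  proof -
    have "x0 \<bullet> y \<le> norm x0 * norm y"
      by (rule norm_cauchy_schwarz)
    also have "\<dots> \<le> r * r"
      using assms(1,3) y by (intro mult_mono) auto
    finally show ?thesis
      by (simp add: power2_eq_square)
  qed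
  have yy: "y \<bullet> y = r\<^sup>2"
    unfolding power2_norm_eq_inner[symmetric] y ..
  have "0 \<le> (l - 1) * ((l - 1) * r\<^sup>2 + 2 * (r\<^sup>2 - x0 \<bullet> y))"
    using l yx by (intro mult_nonneg_nonneg add_nonneg_nonneg) simp_all
  also have "\<dots> = (dist x0 z)\<^sup>2 - (dist x0 y)\<^sup>2"
  proof -
    have *: "(dist x0 (k *\<^sub>R y))\<^sup>2 = x0 \<bullet> x0 - k * (x0 \<bullet> y) - k * (x0 \<bullet> y - k * r\<^sup>2)" for k
      unfolding dist_norm power2_norm_eq_inner inner_diff_left inner_diff_right
        inner_scaleR_left inner_scaleR_right inner_commute[of y x0] yy
      by (simp only: right_diff_distrib)
    have "(dist x0 z)\<^sup>2 = x0 \<bullet> x0 - l * (x0 \<bullet> y) - l * (x0 \<bullet> y - l * r\<^sup>2)"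
      unfolding z by (rule *)
    moreover have "(dist x0 y)\<^sup>2 = x0 \<bullet> x0 - (x0 \<bullet> y) - (x0 \<bullet> y - r\<^sup>2)"
      using *[of 1] by simp
    ultimately show ?thesis
      by algebra
  qed
  finally have "(dist x0 y)\<^sup>2 \<le> (dist x0 z)\<^sup>2"
    by simp
  then show ?thesis
    unfolding y_def[symmetric] by (rule power2_le_imp_le) simp
qed

lemma space_cutoff_bounds:
  assumes "space_cutoff R0 \<psi>0 x0 R \<psi>"
  shows "0 \<le> \<psi> z" and "\<psi> z \<le> \<psi>0 z"
  using assms by (auto simp: space_cutoff_def split: if_splits)

lemma space_cutoff_eq_1:
  assumes "space_cutoff R0 \<psi>0 x0 R \<psi>" and "z \<in> ball x0 R" and "z \<in> ball 0 R0"
  shows "\<psi> z = 1"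
  using assms by (auto simp: space_cutoff_def split: if_splits)

text \<open>
  The ball of radius \<open>2R\<close> about \<open>x0\<close> need not lie in \<open>\<Omega>\<close>; it is the bound \<open>\<psi> \<le> \<psi>\<^sub>0\<close> that keeps the
  support of \<open>\<psi>\<close> there.
\<close>

lemma space_cutoff_test_function:
  assumes "space_cutoff R0 \<psi>0 x0 R \<psi>" and "space_cutoff0 R0 \<psi>0" and "ball 0 (2*R0) \<subseteq> \<Omega>"
  shows "\<psi> \<in> test_functions \<Omega>"
proof -
  have "\<psi>0 \<in> test_functions (ball 0 (2*R0))"
    using assms(2) by (simp add: space_cutoff0_def)
  then obtain C where C: "{x. \<psi>0 x \<noteq> 0} \<subseteq> C" "compact C" "C \<subseteq> ball 0 (2*R0)"
    by (rule test_functionsE)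
  show ?thesis
  proof (rule test_functionsI)
    show "smooth \<psi>"
      using assms(1) by (auto simp: space_cutoff_def test_functions_def split: if_splits)
    show "{x. \<psi> x \<noteq> 0} \<subseteq> C"
    proof
      fix z assume "z \<in> {x. \<psi> x \<noteq> 0}"
      then have "\<psi>0 z \<noteq> 0"
        using space_cutoff_bounds[OF assms(1), of z] by auto
      then show "z \<in> C"
        using C by auto
    qed
  qed (use C assms(3) in auto)
qed

text \<open>
  Outside the ball of radius \<open>R0\<close> the reason depends on the type of the cut-off. If the ball about
  \<open>x0\<close> is inside, then \<open>z\<close> is within \<open>2R\<close> of \<open>x0\<close> and \<open>y\<close> is still closer; otherwise \<open>z\<close> lies on the
  cone over the part of the sphere within \<open>2R\<close> of \<open>x0\<close>, and \<open>y\<close> is the point of the sphere on the ray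
  through \<open>z\<close>.
\<close>

lemma space_cutoff_support:
  assumes cut: "space_cutoff R0 \<psi>0 x0 R \<psi>" and x0: "x0 \<in> ball 0 R0"
    and nz: "\<psi> z \<noteq> 0"
  defines "y \<equiv> (if norm z < R0 then z else (R0 / norm z) *\<^sub>R z)"
  shows "y \<in> ball x0 (2*R)"
proof (cases "ball x0 R \<subseteq> ball 0 R0")
  case True
  then have "\<psi> \<in> test_functions (ball x0 (2*R))"
    using cut by (simp add: space_cutoff_def)
  then have z: "z \<in> ball x0 (2*R)"
    using nz by (blast elim: test_functionsE)
  show ?thesis
  proof (cases "norm z < R0")
    case False
    then have "dist x0 y \<le> dist x0 z"
      unfolding y_def using x0 radial_retraction_closer[of R0 z x0]
      by (simp add: dist_norm) (smt (verit) norm_ge_zero)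
    then show ?thesis
      using z by simp
  qed (use z in \<open>simp add: y_def\<close>)
next
  case False
  show ?thesis
  proof (cases "norm z < R0")
    case True
    then show ?thesis
      using cut False nz by (auto simp: space_cutoff_def y_def)
  next
    case outside: False
    then have "z \<in> cone_part R0 (sphere 0 R0 \<inter> ball x0 (2*R))"
      using cut False nz by (auto simp: space_cutoff_def)
    then obtain s w where sw: "z = s *\<^sub>R w" "norm w = R0" "w \<in> ball x0 (2*R)" "0 \<le> s"
      by (auto simp: cone_part_def)
    have "R0 > 0"
      using x0 by (auto intro: le_less_trans[OF norm_ge_zero])
    then have "s \<noteq> 0"
      using outside sw by auto
    then have "y = w"
      using outside sw \<open>R0 > 0\<close> by (simp add: y_def)
    then show ?thesis
      using sw by simp
  qed
qed

text \<open>
  The bound on the overlap passes to the sphere: the doubled balls being open, those that contain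
  \<open>y\<close> also contain a common point of the open ball close to \<open>y\<close>.
\<close>

lemma K_cover_overlap_cball:
  assumes cover: "K_cover K1 K2 R0 R n x" and y: "y \<in> cball 0 R0" and "R0 > 0"
  shows "card {i\<in>{1..n}. y \<in> ball (x i) (2*R)} \<le> K2"
proof -
  let ?J = "\<lambda>y. {i\<in>{1..n}. y \<in> ball (x i) (2*R)}"
  let ?V = "\<Inter>i\<in>?J y. ball (x i) (2*R)"
  have "y \<in> closure (ball 0 R0)"
    using y \<open>R0 > 0\<close> by simp
  moreover have "open ?V" "y \<in> ?V"
    by (auto intro!: open_INT)
  ultimately obtain y' where y': "y' \<in> ball 0 R0" "y' \<in> ?V"
    unfolding closure_iff_nhds_not_empty by (meson disjoint_iff subset_refl)
  have "card (?J y) \<le> card (?J y')"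
    by (rule card_mono) (use y' in auto)
  also have "\<dots> \<le> K2"
    using cover y' unfolding K_cover_def by blast
  finally show ?thesis .
qed

lemma sum_cutoffs_le:
  assumes cover: "K_cover K1 K2 R0 R n x" and "R0 > 0"
    and cut: "\<And>i. i \<in> {1..n} \<Longrightarrow> space_cutoff R0 \<psi>0 (x i) R (\<psi> i)"
    and \<psi>0: "space_cutoff0 R0 \<psi>0"
  shows "(\<Sum>i=1..n. \<psi> i z) \<le> real K2 * \<psi>0 z"
proof -
  define y where "y = (if norm z < R0 then z else (R0 / norm z) *\<^sub>R z)"
  let ?J = "{i\<in>{1..n}. y \<in> ball (x i) (2*R)}"
  have "(\<Sum>i=1..n. \<psi> i z) = (\<Sum>i\<in>?J. \<psi> i z)"
  proof (rule sum.mono_neutral_right)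
    show "\<forall>i\<in>{1..n} - ?J. \<psi> i z = 0"
      using space_cutoff_support[OF cut, of _ z] cover unfolding y_def K_cover_def by blast
  qed auto
  also have "\<dots> \<le> (\<Sum>i\<in>?J. \<psi>0 z)"
    by (rule sum_mono) (use space_cutoff_bounds[OF cut] in auto)
  also have "\<dots> = real (card ?J) * \<psi>0 z"
    by simp
  also have "\<dots> \<le> real K2 * \<psi>0 z"
  proof (intro mult_right_mono)
    have "y \<in> cball 0 R0"
      using \<open>R0 > 0\<close> by (auto simp: y_def)
    then show "real (card ?J) \<le> real K2"
      using K_cover_overlap_cball[OF cover _ \<open>R0 > 0\<close>] by simp
    show "0 \<le> \<psi>0 z"
      using \<psi>0 by (simp add: space_cutoff0_def)
  qed
  finally show ?thesis .
qed


section \<open>The cut-offs dominate the large cut-off\<close>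

text \<open>
  For \<open>c = 0\<close> this is a plane. For \<open>c \<noteq> 0\<close> the function \<open>a \<bullet> z\<close> is constant in the directions orthogonal
  to \<open>a\<close> while the norm strictly increases from \<open>z\<close> in the directions orthogonal to \<open>z\<close>; in dimension
  three there is a direction \<open>h\<close> orthogonal to both.
\<close>

lemma interior_circular_cone:
  fixes a :: "real^3"
  assumes "c \<noteq> 0 \<or> a \<noteq> 0"
  shows "interior {z. c * norm z = a \<bullet> z} = {}"
proof (rule ccontr)
  assume "interior {z. c * norm z = a \<bullet> z} \<noteq> {}"
  then obtain z e where e: "e > 0" "ball z e \<subseteq> {z. c * norm z = a \<bullet> z}"
    using mem_interior by blast
  have cone: "c * norm (z + h) = a \<bullet> (z + h)" if "norm h < e" for h
    using that e(2) by (auto simp: subset_iff dist_norm)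
  have z: "c * norm z = a \<bullet> z"
    using cone[of 0] e(1) by simp
  show False
  proof (cases "c = 0")
    case True
    then have "a \<noteq> 0"
      using assms by simp
    define h where "h = (e / (2 * norm a)) *\<^sub>R a"
    have "norm h < e"
      using \<open>a \<noteq> 0\<close> e(1) by (simp add: h_def)
    from cone[OF this] have "a \<bullet> h = 0"
      using True z by (simp add: inner_add_right)
    then show False
      using \<open>a \<noteq> 0\<close> e(1) by (simp add: h_def)
  next
    case False
    have "dim {a, z} \<le> card {a, z}"
      by (rule dim_le_card) (auto intro: span_base)
    also have "\<dots> < DIM(real^3)"
      by (cases "a = z") simp_all
    finally have "dim {a, z} < DIM(real^3)" .
    then obtain k where k: "k \<noteq> 0" "\<And>w. w \<in> span {a, z} \<Longrightarrow> orthogonal k w"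
      using orthogonal_to_subspace_exists by blast
    define h where "h = (e / (2 * norm k)) *\<^sub>R k"
    have "h \<noteq> 0" "norm h < e"
      using k(1) e(1) by (auto simp: h_def)
    have "k \<bullet> a = 0" "k \<bullet> z = 0"
      using k(2)[of a] k(2)[of z] by (auto simp: orthogonal_def span_base)
    then have ortho: "a \<bullet> h = 0" "z \<bullet> h = 0"
      by (simp_all add: h_def inner_commute)
    have "c * norm (z + h) = c * norm z"
      using cone[OF \<open>norm h < e\<close>] z ortho by (simp add: inner_add_right)
    then have "(z + h) \<bullet> (z + h) = z \<bullet> z"
      using False by (simp add: dot_square_norm)
    then show False
      using ortho \<open>h \<noteq> 0\<close> by (simp add: inner_add_left inner_add_right inner_commute)
  qed
qed

lemma interior_finite_Union_empty:
  assumes "finite I" and "\<And>i. i \<in> I \<Longrightarrow> closed (N i)" and "\<And>i. i \<in> I \<Longrightarrow> interior (N i) = {}"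
  shows "interior (\<Union>i\<in>I. N i) = {}"
  using assms
proof (induction I rule: finite_induct)
  case (insert i I)
  then show ?case
    using interior_closed_Un_empty_interior[of "N i" "\<Union>i\<in>I. N i"] by simp
qed simp

lemma cover_touches_sphere:
  assumes cover: "K_cover K1 K2 R0 R n x" and "R0 > 0" and "norm y = R0"
  obtains i where "i \<in> {1..n}" "dist (x i) y \<le> R"
proof -
  have "closure (ball 0 R0) \<subseteq> (\<Union>i\<in>{1..n}. cball (x i) R)"
  proof (rule closure_minimal)
    show "ball 0 R0 \<subseteq> (\<Union>i\<in>{1..n}. cball (x i) R)"
      using cover ball_subset_cball unfolding K_cover_def by blast
  qed (auto intro: closed_UN)
  moreover have "y \<in> closure (ball 0 R0)"
    using assms by simp
  ultimately show ?thesis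
    using that by fastforce
qed

text \<open>
  Off the sets \<open>N i\<close>, the radial projection of a point outside the ball of radius \<open>R0\<close> does not lie on
  the boundary of a covering ball, hence lies in one of the open balls. The sets \<open>N i\<close> are closed
  cones with empty interior, so that this settles a dense set of points; both sides of the inequality
  are continuous.
\<close>

lemma le_sum_cutoffs:
  assumes cover: "K_cover K1 K2 R0 R n x" and R0: "R0 > 0"
    and cut: "\<And>i. i \<in> {1..n} \<Longrightarrow> space_cutoff R0 \<psi>0 (x i) R (\<psi> i)"
    and full: "\<And>i. i \<in> {1..n} \<Longrightarrow> x i = 0 \<Longrightarrow> R = R0 \<Longrightarrow> \<psi> i = \<psi>0"
    and \<psi>0: "space_cutoff0 R0 \<psi>0"
    and R: "0 < R"
  shows "\<psi>0 z \<le> (\<Sum>i=1..n. \<psi> i z)"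
proof -
  have dominates: "\<psi>0 w \<le> (\<Sum>i=1..n. \<psi> i w)" if "i \<in> {1..n}" "\<psi>0 w \<le> \<psi> i w" for i w
  proof -
    have "\<psi> i w \<le> (\<Sum>i=1..n. \<psi> i w)"
      by (rule member_le_sum[OF that(1)]) (use space_cutoff_bounds(1)[OF cut] in auto)
    then show ?thesis
      using that(2) by simp
  qed
  show ?thesis
  proof (cases "\<exists>i\<in>{1..n}. x i = 0 \<and> R = R0")
    case True
    then obtain i where "i \<in> {1..n}" "\<psi> i = \<psi>0"
      using full by blast
    then show ?thesis
      by (intro dominates[of i]) auto
  next
    case False
    \<comment> \<open>
      the points whose radial projection to the sphere \<open>S(0, R0)\<close> lies on the sphere \<open>S(x i, R)\<close>,
      and the origin
    \<close>
    define N where "N i = {w. (R0\<^sup>2 + (norm (x i))\<^sup>2 - R\<^sup>2) * norm w = (2 * R0) *\<^sub>R x i \<bullet> w}" for i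
    have "interior (\<Union>i\<in>{1..n}. N i) = {}"
    proof (rule interior_finite_Union_empty)
      fix i assume i: "i \<in> {1..n}"
      show "closed (N i)"
        unfolding N_def by (intro closed_Collect_eq continuous_intros)
      have "R0\<^sup>2 + (norm (x i))\<^sup>2 - R\<^sup>2 \<noteq> 0 \<or> (2 * R0) *\<^sub>R x i \<noteq> 0"
      proof (cases "x i = 0")
        case True
        then have "R \<noteq> R0"
          using False i by auto
        then show ?thesis
          using True R R0 by (simp add: power2_eq_iff_nonneg)
      qed (use R0 in auto)
      then show "interior (N i) = {}"
        unfolding N_def by (rule interior_circular_cone)
    qed simp
    then have dense: "closure (- (\<Union>i\<in>{1..n}. N i)) = UNIV"
      by (simp only: closure_complement Compl_empty_eq)
    have smooth_cont: "continuous_on UNIV f" if "f \<in> test_functions U" for f :: "real^3 \<Rightarrow> real" and U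
    proof -
      have "Ck 0 f"
        using that unfolding test_functions_def smooth_def by blast
      then show ?thesis
        by simp
    qed
    have "closed {w. \<psi>0 w \<le> (\<Sum>i=1..n. \<psi> i w)}"
    proof (intro closed_Collect_le continuous_on_sum)
      show "continuous_on UNIV \<psi>0"
        using \<psi>0 smooth_cont by (auto simp: space_cutoff0_def)
      show "continuous_on UNIV (\<psi> i)" if "i \<in> {1..n}" for i
        by (rule smooth_cont[OF space_cutoff_test_function[OF cut[OF that] \<psi>0 order_refl]])
    qed
    moreover have "- (\<Union>i\<in>{1..n}. N i) \<subseteq> {w. \<psi>0 w \<le> (\<Sum>i=1..n. \<psi> i w)}"
    proof
      fix w assume w: "w \<in> - (\<Union>i\<in>{1..n}. N i)"
      consider "norm w < R0" | "R0 \<le> norm w" "norm w \<le> 2 * R0" | "2 * R0 < norm w"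
        by linarith
      then have "\<psi>0 w \<le> (\<Sum>i=1..n. \<psi> i w)"
      proof cases
        case 1
        then obtain i where i: "i \<in> {1..n}" "w \<in> ball (x i) R"
          using cover unfolding K_cover_def mem_ball_0[symmetric] by blast
        have "\<psi> i w = 1"
          using space_cutoff_eq_1[OF cut[OF i(1)] i(2)] 1 by simp
        then show ?thesis
          using dominates[OF i(1)] \<psi>0 by (simp add: space_cutoff0_def)
      next
        case 2
        define y where "y = (R0 / norm w) *\<^sub>R w"
        have y: "norm y = R0" and w_eq: "w = (norm w / R0) *\<^sub>R y"
          using 2 R0 by (auto simp: y_def)
        obtain i where i: "i \<in> {1..n}" "dist (x i) y \<le> R"
          using cover_touches_sphere[OF cover R0 y] .
        have "dist (x i) y \<noteq> R"
        proof
          assume "dist (x i) y = R"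
          then have "R\<^sup>2 = (x i - y) \<bullet> (x i - y)"
            unfolding dist_norm using power2_norm_eq_inner[of "x i - y"] by simp
          also have "\<dots> = (norm (x i))\<^sup>2 + R0\<^sup>2 - 2 * (x i \<bullet> y)"
            using y power2_norm_eq_inner[of y] power2_norm_eq_inner[of "x i"]
            by (simp add: inner_diff_left inner_diff_right inner_commute[of y "x i"])
          finally have "R0\<^sup>2 + (norm (x i))\<^sup>2 - R\<^sup>2 = 2 * (x i \<bullet> y)"
            by simp
          then have "(R0\<^sup>2 + (norm (x i))\<^sup>2 - R\<^sup>2) * norm w = (2 * R0) *\<^sub>R x i \<bullet> w"
            using 2 R0 by (simp add: y_def)
          then show False
            using w i(1) by (auto simp: N_def)
        qed
        then have y_ball: "y \<in> sphere 0 R0 \<inter> ball (x i) R"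
          using i(2) y by simp
        then have "\<not> ball (x i) R \<subseteq> ball 0 R0"
          using y by auto
        moreover have "w \<in> cone_part R0 (sphere 0 R0 \<inter> ball (x i) R)"
          unfolding cone_part_def
        proof (intro CollectI exI conjI)
          show "w = (norm w / R0) *\<^sub>R y"
            by (rule w_eq)
          show "R0 \<le> norm ((norm w / R0) *\<^sub>R y)" "norm ((norm w / R0) *\<^sub>R y) \<le> 2 * R0"
            using 2 w_eq by metis+
        qed (use y_ball R0 in auto)
        ultimately have "\<psi> i w = \<psi>0 w"
          using cut[OF i(1)] by (simp add: space_cutoff_def)
        then show ?thesis
          using dominates[OF i(1)] by simp
      next
        case 3
        have "\<psi>0 \<in> test_functions (ball 0 (2*R0))"
          using \<psi>0 by (simp add: space_cutoff0_def)
        then have "\<psi>0 w = 0"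
        proof (rule test_functionsE)
          fix C assume "{x. \<psi>0 x \<noteq> 0} \<subseteq> C" "C \<subseteq> ball 0 (2*R0)"
          moreover have "w \<notin> ball 0 (2*R0)"
            using 3 by simp
          ultimately show ?thesis
            by blast
        qed
        then show ?thesis
          using space_cutoff_bounds(1)[OF cut] by (auto intro!: sum_nonneg)
      qed
      then show "w \<in> {w. \<psi>0 w \<le> (\<Sum>i=1..n. \<psi> i w)}"
        by simp
    qed
    ultimately have "closure (- (\<Union>i\<in>{1..n}. N i)) \<subseteq> {w. \<psi>0 w \<le> (\<Sum>i=1..n. \<psi> i w)}"
      by (rule closure_minimal[rotated])
    then show ?thesis
      using dense by blast
  qed
qed


section \<open>Comparison of the averaged dissipations\<close>

lemma sum_dissipation_bounds:
  assumes euler: "weak_Euler_solution \<Omega> T u p" and energy: "local_energy_inequality \<Omega> T u p"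
    and \<Omega>: "ball 0 (2*R0) \<subseteq> \<Omega>" and R: "0 < R" "R \<le> R0"
    and \<eta>: "time_cutoff T \<delta> C0 \<eta>" and \<psi>0: "space_cutoff0 R0 \<psi>0"
    and \<psi>: "space_cutoff_family R0 \<psi>0 \<psi>" and cover: "K_cover K1 K2 R0 R n x"
  shows "0 \<le> dissipation \<Omega> T u p (cutoff \<eta> \<psi>0)"
    and "dissipation \<Omega> T u p (cutoff \<eta> \<psi>0) \<le>
      (\<Sum>i=1..n. dissipation \<Omega> T u p (cutoff \<eta> (\<psi> (x i) R)))"
    and "(\<Sum>i=1..n. dissipation \<Omega> T u p (cutoff \<eta> (\<psi> (x i) R))) \<le>
      real K2 * dissipation \<Omega> T u p (cutoff \<eta> \<psi>0)"
proof -
  let ?D = "dissipation \<Omega> T u p"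
  let ?\<phi> = "\<lambda>i. cutoff \<eta> (\<psi> (x i) R)"
  have up: "Lp_loc 3 (space_time \<Omega> T) u" "Lp_loc (3/2) (space_time \<Omega> T) p"
    using euler by (auto simp: weak_Euler_solution_def)
  have cut: "space_cutoff R0 \<psi>0 (x i) R (\<psi> (x i) R)" if "i \<in> {1..n}" for i
    using \<psi> cover R that unfolding space_cutoff_family_def K_cover_def by blast
  have full: "\<psi> (x i) R = \<psi>0" if "x i = 0" "R = R0" for i
    using \<psi> that by (simp add: space_cutoff_family_def)
  have "space_cutoff R0 \<psi>0 0 R0 \<psi>0"
  proof -
    have "0 \<in> ball (0::real^3) R0" "0 < R0" "R0 \<le> R0"
      using R by simp_all
    then have "space_cutoff R0 \<psi>0 0 R0 (\<psi> 0 R0)" "\<psi> 0 R0 = \<psi>0"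
      using \<psi> unfolding space_cutoff_family_def by blast+
    then show ?thesis
      by simp
  qed
  note \<psi>0_test = space_cutoff_test_function[OF this \<psi>0 \<Omega>]
  have \<eta>_test: "\<eta> \<in> test_functions {0<..<2*T}" and \<eta>_nonneg: "\<And>t. 0 \<le> \<eta> t"
    using \<eta> by (auto simp: time_cutoff_def)
  have \<phi>0: "cutoff \<eta> \<psi>0 \<in> test_functions (space_time \<Omega> T)"
    by (rule cutoff_test_functions[OF \<eta>_test \<psi>0_test])
  have \<phi>: "?\<phi> i \<in> test_functions (space_time \<Omega> T)" if "i \<in> {1..n}" for i
    by (rule cutoff_test_functions[OF \<eta>_test space_cutoff_test_function[OF cut[OF that] \<psi>0 \<Omega>]])
  have sum_\<phi>: "(\<lambda>z. \<Sum>i=1..n. ?\<phi> i z) \<in> test_functions (space_time \<Omega> T)"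
    by (rule test_functions_sum[OF \<phi>])
  have D_sum: "?D (\<lambda>z. \<Sum>i=1..n. ?\<phi> i z) = (\<Sum>i=1..n. ?D (?\<phi> i))"
    by (rule dissipation_sum[OF up _ \<phi>]) auto
  have sum_eq: "(\<Sum>i=1..n. ?\<phi> i z) = \<eta> (snd z) * (\<Sum>i=1..n. \<psi> (x i) R (fst z))" for z
    by (simp add: cutoff_def case_prod_beta sum_distrib_left)
  have "R0 > 0"
    using R by simp
  show "0 \<le> ?D (cutoff \<eta> \<psi>0)"
  proof -
    have "\<forall>z. 0 \<le> cutoff \<eta> \<psi>0 z"
      using \<eta>_nonneg \<psi>0 by (simp add: cutoff_def space_cutoff0_def case_prod_beta)
    then show ?thesis
      using energy \<phi>0 unfolding local_energy_inequality_def by blast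
  qed
  show "?D (cutoff \<eta> \<psi>0) \<le> (\<Sum>i=1..n. ?D (?\<phi> i))"
    unfolding D_sum[symmetric]
  proof (rule dissipation_mono[OF up energy \<phi>0 sum_\<phi>])
    show "cutoff \<eta> \<psi>0 z \<le> (\<Sum>i=1..n. ?\<phi> i z)" for z
      unfolding sum_eq unfolding cutoff_def case_prod_beta
      by (intro mult_left_mono le_sum_cutoffs[OF cover \<open>R0 > 0\<close> cut full \<psi>0 R(1)] \<eta>_nonneg)
  qed
  show "(\<Sum>i=1..n. ?D (?\<phi> i)) \<le> real K2 * ?D (cutoff \<eta> \<psi>0)"
    unfolding D_sum[symmetric] dissipation_scale[OF up \<phi>0, symmetric]
  proof (rule dissipation_mono[OF up energy sum_\<phi>])
    show "(\<lambda>z. real K2 * cutoff \<eta> \<psi>0 z) \<in> test_functions (space_time \<Omega> T)"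
      using test_functions_lincomb[OF \<phi>0 \<phi>0, of "real K2" 0] by simp
    show "(\<Sum>i=1..n. ?\<phi> i z) \<le> real K2 * cutoff \<eta> \<psi>0 z" for z
    proof -
      have "\<eta> (snd z) * (\<Sum>i=1..n. \<psi> (x i) R (fst z)) \<le> \<eta> (snd z) * (real K2 * \<psi>0 (fst z))"
        by (intro mult_left_mono sum_cutoffs_le[OF cover \<open>R0 > 0\<close> cut \<psi>0] \<eta>_nonneg)
      then show ?thesis
        unfolding sum_eq by (simp add: cutoff_def case_prod_beta algebra_simps)
    qed
  qed
qed

theorem lemma1p1:
  fixes K1 K2 :: nat
  assumes "K1 > 0" and "K2 > 0"
  shows "\<exists>K::real. K > 1 \<and>
    (\<forall>(T::real) (R0::real) (\<Omega>::(real^3) set)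
       (u::(real^3) \<times> real \<Rightarrow> real^3) (p::(real^3) \<times> real \<Rightarrow> real)
       (\<psi>0::real^3 \<Rightarrow> real) (\<delta>::real) (C0::real) (\<eta>::real \<Rightarrow> real)
       (\<psi>::real^3 \<Rightarrow> real \<Rightarrow> real^3 \<Rightarrow> real).
       T > 0 \<and> R0 > 0 \<and> open \<Omega> \<and> ball 0 (2*R0) \<subseteq> \<Omega> \<and>
       weak_Euler_solution \<Omega> T u p \<and> local_energy_inequality \<Omega> T u p \<and>
       0 < \<delta> \<and> \<delta> \<le> 1 \<and> C0 > 0 \<and> time_cutoff T \<delta> C0 \<eta> \<and>
       space_cutoff0 R0 \<psi>0 \<and> space_cutoff_family R0 \<psi>0 \<psi> \<longrightarrow>
       (\<forall>(R::real) (n::nat) (x::nat \<Rightarrow> real^3).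
          0 < R \<and> R \<le> R0 \<and> K_cover K1 K2 R0 R n x \<longrightarrow>
          1 / K * eps0 \<Omega> T u p \<eta> \<psi>0 R0 \<le> epsR \<Omega> T u p \<eta> \<psi> R n x \<and>
          epsR \<Omega> T u p \<eta> \<psi> R n x \<le> K * eps0 \<Omega> T u p \<eta> \<psi>0 R0))"
proof (intro exI[of _ "real K1 + real K2"] conjI allI impI)
  show "real K1 + real K2 > 1"
    using assms by linarith
next
  fix T R0 \<delta> C0 :: real and \<Omega> u p \<psi>0 \<eta> \<psi> and R :: real and n :: nat and x
  assume A: "T > 0 \<and> R0 > 0 \<and> open \<Omega> \<and> ball 0 (2*R0) \<subseteq> \<Omega> \<and>
       weak_Euler_solution \<Omega> T u p \<and> local_energy_inequality \<Omega> T u p \<and>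
       0 < \<delta> \<and> \<delta> \<le> 1 \<and> C0 > 0 \<and> time_cutoff T \<delta> C0 \<eta> \<and>
       space_cutoff0 R0 \<psi>0 \<and> space_cutoff_family R0 \<psi>0 \<psi>"
    and B: "0 < R \<and> R \<le> R0 \<and> K_cover K1 K2 R0 R n x"
  define D0 where "D0 = dissipation \<Omega> T u p (cutoff \<eta> \<psi>0)"
  define D where "D = (\<Sum>i=1..n. dissipation \<Omega> T u p (cutoff \<eta> (\<psi> (x i) R)))"
  have D: "0 \<le> D0" "D0 \<le> D" "D \<le> real K2 * D0"
    unfolding D0_def D_def
    using A B sum_dissipation_bounds[of \<Omega> T u p R0 R \<delta> C0 \<eta> \<psi>0 \<psi> K1 K2 n x] by blast+
  have pos: "T > 0" "R0 > 0" "R > 0"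
    using A B by auto
  have n: "R0^3 \<le> real n * R^3" "real n * R^3 \<le> real K1 * R0^3"
    using B pos by (auto simp: K_cover_def power_divide field_simps)
  have nR: "real n * R^3 > 0"
    using n(1) zero_less_power[OF pos(2), of 3] by linarith
  have eps0: "eps0 \<Omega> T u p \<eta> \<psi>0 R0 = D0 / (T * R0^3)"
    by (simp add: eps0_def D0_def)
  have epsR: "epsR \<Omega> T u p \<eta> \<psi> R n x = D / (T * (real n * R^3))"
    by (simp add: epsR_def D_def sum_divide_distrib sum_distrib_left mult_ac)
  let ?K = "real K1 + real K2"
  have "D0 * (real n * R^3) \<le> D * (?K * R0^3)"
  proof -
    have "D0 * (real n * R^3) \<le> D * (real K1 * R0^3)"
      by (rule mult_mono) (use D n nR pos in simp_all)
    also have "\<dots> \<le> D * (?K * R0^3)"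
      using D pos by (intro mult_left_mono mult_right_mono) simp_all
    finally show ?thesis .
  qed
  then show "1 / ?K * eps0 \<Omega> T u p \<eta> \<psi>0 R0 \<le> epsR \<Omega> T u p \<eta> \<psi> R n x"
    unfolding eps0 epsR using pos nR assms by (simp add: divide_simps mult_ac)
  have "D * R0^3 \<le> ?K * D0 * (real n * R^3)"
  proof -
    have "D * R0^3 \<le> real K2 * D0 * (real n * R^3)"
      by (rule mult_mono) (use D n pos in simp_all)
    also have "\<dots> \<le> ?K * D0 * (real n * R^3)"
      by (intro mult_right_mono) (use D nR in simp_all)
    finally show ?thesis .
  qed
  then show "epsR \<Omega> T u p \<eta> \<psi> R n x \<le> ?K * eps0 \<Omega> T u p \<eta> \<psi>0 R0"
    unfolding eps0 epsR using pos nR by (simp add: divide_simps mult_ac)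
qed

end
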